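(* Let $\mathsf{MonKey}$ be an injective map from the monomials of $\mathbb{F}_p[x_1,\dots,x_n]$ to a totally ordered set of keys such that $u\prec v$ implies $\mathsf{MonKey}(u)<\mathsf{MonKey}(v)$ for all monomials $u,v$. Suppose the FBSP algorithm described in the context produces $(\mathcal{T},\mathcal{R},\Pi)$ with $\mathcal{R}=\{(t_i,g_{k_i})\}_{i=1}^r$, $\mathcal{T}=\{m_1\succ\cdots\succ m_N\}$ and $\Pi=(\texttt{row\_ptr},\texttt{col\_ind},\texttt{val},\texttt{dict\_keys},\texttt{row\_meta})$. Let $A\in\mathbb{F}_p^{r\times N}$ be the matrix whose entry $A_{i,j}$ is the coefficient of $m_j$ in $t_i g_{k_i}$. Then the sparse buffers in $\Pi$ encode exactly the nonzero pattern and the coefficients of $A$: for each row $i$ and each $u\in\operatorname{supp}(t_i g_{k_i})$, the algorithm writes, in the segment of positions $[\texttt{row\_ptr}[i],\texttt{row\_ptr}[i+1])$ belonging to row $i$, an entry with $$\texttt{col\_ind}=\mathrm{index}_{\mathcal{T}}(u),\qquad \texttt{val}=\text{the coefficient of } u \text{ in } t_i g_{k_i},$$ and no other nonzeros are written.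
   Context: Setting: $p$ is prime, $\mathbb{F}_p[x_1,\dots,x_n]$ carries a fixed term order $\prec$, and $G$ is a finite set of polynomials. $\operatorname{supp}(f)$ is the set of monomials occurring in $f$ with nonzero coefficient. For $u\in\mathcal{T}=\{m_1\succ\cdots\succ m_N\}$, $\mathrm{index}_{\mathcal{T}}(u)$ is the $j\in\{1,\dots,N\}$ with $u=m_j$. For each $g_k\in G$, its monomials in $\prec$-order, largest first, are written $m_{k,0}\succ m_{k,1}\succ\cdots$ with nonzero coefficients $c_{k,0},c_{k,1},\dots\in\mathbb{F}_p$. $[a,b)$ denotes the set of integers $q$ with $a\le q<b$. FBSP algorithm. (0) Row selection produces a list $\mathcal{R}=\{(t_i,g_{k_i})\}_{i=1}^r$ with $t_i$ a monomial and $g_{k_i}\in G$. (1) Count: compute $\ell_i=|\operatorname{supp}(t_i g_{k_i})|$, $\texttt{row\_ptr}[1]=0$, $\texttt{row\_ptr}[i+1]=\texttt{row\_ptr}[i]+\ell_i$, $M=\sum_i\ell_i$. Allocate arrays $\texttt{row\_key}$, $\texttt{row\_val}$, indexed by $0,\dots,M-1$. (2) Fill: in parallel for $i=1,\dots,r$, with $s=\texttt{row\_ptr}[i]$, for $j=0,\dots,\ell_i-1$ write $\texttt{row\_key}[s+j]\leftarrow\mathsf{MonKey}(t_i\cdot m_{k_i,j})$ and $\texttt{row\_val}[s+j]\leftarrow c_{k_i,j}$. (3) Dictionary: sort (a copy of) the array $\texttt{row\_key}$ by key, largest first, and remove duplicates, obtaining the array $\texttt{dict\_keys}$ of length $N$;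 this encodes the dictionary $\mathcal{T}=\{m_1\succ\cdots\succ m_N\}$, where $\mathsf{MonKey}(m_j)$ is the $j$-th entry of $\texttt{dict\_keys}$. (4) Row assembly: allocate $\texttt{col\_ind}$, indexed by $0,\dots,M-1$; in parallel for $i=1,\dots,r$, for each position $q\in[\texttt{row\_ptr}[i],\texttt{row\_ptr}[i+1])$, set $\texttt{col\_ind}[q]$ to the index $j\in\{1,\dots,N\}$ at which $\texttt{row\_key}[q]$ occurs in $\texttt{dict\_keys}$. (5) Output $\mathcal{T}$, $\mathcal{R}$ and $\Pi=(\texttt{row\_ptr},\texttt{col\_ind},\texttt{val},\texttt{dict\_keys},\texttt{row\_meta})$, where $\texttt{val}=\texttt{row\_val}$ and $\texttt{row\_meta}$ stores $(t_i,k_i)$ for each row $i$. Position $q\in[\texttt{row\_ptr}[i],\texttt{row\_ptr}[i+1])$ encodes a matrix entry $\texttt{val}[q]$ in row $i$, column $\texttt{col\_ind}[q]$. *)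

theory Defs
  imports
    "HOL-Library.Poly_Mapping"
    "HOL-Library.Multiset"
    "Berlekamp_Zassenhaus.Finite_Field"
    "Jordan_Normal_Form.Matrix"
begin

text \<open>
  Monomials are exponent vectors (so the product of monomials is addition of exponents and the
  monomial 1 is the zero vector), indexed by a finite nonempty type of variables; polynomials
  are finitely supported maps from monomials to coefficients, with the convolution product of
  \<^theory>\<open>HOL-Library.Poly_Mapping\<close>. The field with p elements is \<open>'p mod_ring\<close> with
  p = CARD('p), and \<open>'p :: prime_card\<close> says that p is prime.
\<close>

type_synonym 'n mon = "'n \<Rightarrow>\<^sub>0 nat"
type_synonym ('n, 'p) mpoly_Fp = "('n \<Rightarrow>\<^sub>0 nat) \<Rightarrow>\<^sub>0 'p mod_ring"

definition supp :: "('n, 'p :: prime_card) mpoly_Fp \<Rightarrow> 'n mon set" where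
  "supp f = Poly_Mapping.keys f"

definition coeff_of :: "('n, 'p :: prime_card) mpoly_Fp \<Rightarrow> 'n mon \<Rightarrow> 'p mod_ring" where
  "coeff_of f u = Poly_Mapping.lookup f u"

definition mon_times :: "'n mon \<Rightarrow> ('n, 'p :: prime_card) mpoly_Fp \<Rightarrow> ('n, 'p) mpoly_Fp" where
  "mon_times t f = Poly_Mapping.single t 1 * f"

text \<open>\<open>prec u v\<close> stands for u \<prec> v (strict).\<close>

definition term_order :: "('n mon \<Rightarrow> 'n mon \<Rightarrow> bool) \<Rightarrow> bool" where
  "term_order prec \<longleftrightarrow>
     irreflp prec \<and> transp prec \<and> totalp prec \<and>
     (\<forall>t u v. prec u v \<longrightarrow> prec (t + u) (t + v)) \<and>
     (\<forall>u. u \<noteq> 0 \<longrightarrow> prec 0 u)"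

text \<open>The support of f, listed with the largest monomial first.\<close>

definition mons_desc ::
  "('n mon \<Rightarrow> 'n mon \<Rightarrow> bool) \<Rightarrow> ('n, 'p :: prime_card) mpoly_Fp \<Rightarrow> 'n mon list" where
  "mons_desc prec f = (THE ms. sorted_wrt (\<lambda>u v. prec v u) ms \<and> set ms = supp f)"

text \<open>
  Rows, columns and the entries of \<open>row_ptr\<close> are numbered from 1, whereas the positions in the
  buffers and the monomials of a polynomial are numbered from 0. Lists of the former kind are
  accessed by the following 1-based variant of \<open>!\<close>.
\<close>

abbreviation nth1 :: "'a list \<Rightarrow> nat \<Rightarrow> 'a" (infixl "!\<^sub>1" 100) where
  "xs !\<^sub>1 i \<equiv> xs ! (i - 1)"

definition index_in :: "'a list \<Rightarrow> 'a \<Rightarrow> nat" where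
  "index_in xs x = (THE j. 1 \<le> j \<and> j \<le> length xs \<and> xs !\<^sub>1 j = x)"

fun prefix_sums :: "nat \<Rightarrow> nat list \<Rightarrow> nat list" where
  "prefix_sums s [] = [s]"
| "prefix_sums s (l # ls) = s # prefix_sums (s + l) ls"

text \<open>The segment of positions belonging to row i.\<close>

definition seg :: "nat list \<Rightarrow> nat \<Rightarrow> nat set" where
  "seg rp i = {rp !\<^sub>1 i ..< rp !\<^sub>1 (i + 1)}"

text \<open>
  A write is a pair of a position and a value. A parallel phase performs a given collection of
  writes in an unspecified order; in particular this covers every interleaving of the rows.
\<close>

definition par_exec :: "(nat \<times> 'a) list \<Rightarrow> 'a list \<Rightarrow> 'a list \<Rightarrow> bool" where
  "par_exec ws a a' \<longleftrightarrow>
     (\<exists>sch. mset sch = mset ws \<and> a' = fold (\<lambda>(q, x) b. b[q := x]) sch a)"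

record ('n, 'p, 'k) buffers =
  row_ptr :: "nat list"
  col_ind :: "nat list"
  val :: "'p mod_ring list"
  dict_keys :: "'k list"
  row_meta :: "('n mon \<times> nat) list"

text \<open>The writes of row i in the fill phase; \<open>F\<close> is \<open>MonKey\<close> composed with the multiplication
  by the monomial of the row for the key array, and the coefficient function for the value array.\<close>

definition fill_writes ::
  "('n mon \<Rightarrow> 'n mon \<Rightarrow> bool) \<Rightarrow> nat \<Rightarrow> nat \<Rightarrow> ('n, 'p :: prime_card) mpoly_Fp \<Rightarrow>
    ('n mon \<Rightarrow> 'x) \<Rightarrow> (nat \<times> 'x) list" where
  "fill_writes prec s l f F = map (\<lambda>j. (s + j, F (mons_desc prec f ! j))) [0..<l]"

text \<open>
  \<open>FBSP prec MonKey G g T R P\<close>: some run of the algorithm outputs T, R and the buffers P, where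
  \<open>g 1, \<dots>, g (card G)\<close> enumerates G. Row selection (\<open>sel\<close>, the list of pairs of a monomial
  and an index into G) is arbitrary. Freshly allocated arrays (\<open>key0\<close>, \<open>val0\<close>, \<open>col0\<close>) have the
  right length but arbitrary contents. The dictionary T is decoded from \<open>dict_keys\<close>.
\<close>

definition FBSP ::
  "('n mon \<Rightarrow> 'n mon \<Rightarrow> bool) \<Rightarrow> ('n mon \<Rightarrow> 'k :: linorder) \<Rightarrow>
    ('n, 'p :: prime_card) mpoly_Fp set \<Rightarrow> (nat \<Rightarrow> ('n, 'p) mpoly_Fp) \<Rightarrow>
    'n mon list \<Rightarrow> ('n mon \<times> ('n, 'p) mpoly_Fp) list \<Rightarrow> ('n, 'p, 'k) buffers \<Rightarrow> bool" where
  "FBSP prec MonKey G g T R P \<longleftrightarrow>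
    (\<exists>sel ls M key0 val0 col0 row_key row_val.
      (\<forall>(t, k) \<in> set sel. k \<in> {1..card G}) \<and>
      R = map (\<lambda>(t, k). (t, g k)) sel \<and>
      ls = map (\<lambda>(t, f). card (supp (mon_times t f))) R \<and>
      row_ptr P = prefix_sums 0 ls \<and>
      M = sum_list ls \<and>
      length key0 = M \<and> length val0 = M \<and>
      par_exec (concat (map (\<lambda>i. case R !\<^sub>1 i of (t, f) \<Rightarrow>
          fill_writes prec (row_ptr P !\<^sub>1 i) (ls !\<^sub>1 i) f (\<lambda>m. MonKey (t + m)))
        [1..<length R + 1])) key0 row_key \<and>
      par_exec (concat (map (\<lambda>i. case R !\<^sub>1 i of (t, f) \<Rightarrow>
          fill_writes prec (row_ptr P !\<^sub>1 i) (ls !\<^sub>1 i) f (coeff_of f))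
        [1..<length R + 1])) val0 row_val \<and>
      dict_keys P = remdups_adj (rev (sort row_key)) \<and>
      T = map (inv_into UNIV MonKey) (dict_keys P) \<and>
      length col0 = M \<and>
      par_exec (concat (map (\<lambda>i.
          map (\<lambda>q. (q, index_in (dict_keys P) (row_key ! q)))
            [row_ptr P !\<^sub>1 i ..< row_ptr P !\<^sub>1 (i + 1)])
        [1..<length R + 1])) col0 (col_ind P) \<and>
      val P = row_val \<and>
      row_meta P = sel)"

text \<open>The matrix A; \<open>mat\<close> and \<open>$$\<close> number rows and columns from 0.\<close>

definition coeff_matrix ::
  "'n mon list \<Rightarrow> ('n mon \<times> ('n, 'p :: prime_card) mpoly_Fp) list \<Rightarrow> 'p mod_ring mat" where
  "coeff_matrix T R = mat (length R) (length T)
     (\<lambda>(i, j). case R ! i of (t, f) \<Rightarrow> coeff_of (mon_times t f) (T ! j))"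

text \<open>
  The buffers are a sparse row encoding of exactly the nonzero entries of A: the segments fill
  the buffers completely, and within row i the positions correspond one-to-one (through
  \<open>ci\<close>) to the columns with a nonzero entry, with \<open>vl\<close> giving that entry.
\<close>

definition encodes_matrix ::
  "nat list \<Rightarrow> nat list \<Rightarrow> 'a :: zero list \<Rightarrow> 'a mat \<Rightarrow> bool" where
  "encodes_matrix rp ci vl A \<longleftrightarrow>
     length ci = length vl \<and>
     length rp = dim_row A + 1 \<and> sorted rp \<and>
     rp !\<^sub>1 1 = 0 \<and> rp !\<^sub>1 (dim_row A + 1) = length vl \<and>
     (\<forall>i \<in> {1..dim_row A}.
        inj_on (\<lambda>q. ci ! q) (seg rp i) \<and>
        (\<lambda>q. (ci ! q, vl ! q)) ` seg rp i =
          {(j, A $$ (i - 1, j - 1)) | j. j \<in> {1..dim_col A} \<and> A $$ (i - 1, j - 1) \<noteq> 0})"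

end

theory Submission
  imports Defs
begin

text \<open>Everything rests on one bijection per row. Multiplication by a monomial \<open>t\<close>
  is injective on exponent vectors and carries coefficients along unchanged
  (\<open>supp_mon_times\<close>, \<open>coeff_of_mon_times\<close>), so the counted length of a row
  is the number of monomials enumerated when the row is filled. Hence the positions of row i
  correspond one-to-one to the support of the row polynomial (\<open>mon_bij\<close> in the main
  proof).

  The parallel phases are harmless: prefix sums cut the buffers into disjoint segments
  (\<open>seg_disjoint\<close>), so each cell is offered a single value whatever the schedule
  (\<open>par_exec_rows_nth\<close>). The segments also cover the buffers
  (\<open>seg_cover\<close>), so no initial content survives and the dictionary holds exactly the
  keys of the monomials in the row supports. Injectivity of \<open>MonKey\<close> makes decoding
  lossless, and a key lookup returns the index of the monomial in \<open>T\<close>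
  (\<open>index_in_map\<close>). As the nonzero entries of a row of A sit at the indices of its
  support, composing the bijection with the injective index map gives both claims.\<close>

section \<open>Monomials and supports\<close>

text \<open>In the convolution only the exponent \<open>t\<close> of the first factor contributes,
  and cancelling \<open>t\<close> in \<open>t + u = t + q\<close> leaves the single term
  \<open>q = u\<close>.\<close>

lemma coeff_of_mon_times [simp]: "coeff_of (mon_times t f) (t + u) = coeff_of f u"
proof -
  have "coeff_of (mon_times t f) (t + u) =
      (\<Sum>l. (\<Sum>q. Poly_Mapping.lookup f q when t + u = l + q) when t = l)"
    unfolding coeff_of_def mon_times_def lookup_mult lookup_single when_mult by simp
  also have "\<dots> = (\<Sum>q. Poly_Mapping.lookup f q when t + u = t + q)"
    by (rule Sum_any_when_equal')
  also have "\<dots> = coeff_of f u"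
    unfolding add_left_cancel coeff_of_def by (rule Sum_any_when_equal')
  finally show ?thesis .
qed

lemma supp_mon_times: "supp (mon_times t f) = (+) t ` supp f"
proof
  show "supp (mon_times t f) \<subseteq> (+) t ` supp f"
    using keys_mult[of "Poly_Mapping.single t 1" f]
    by (auto simp: supp_def mon_times_def split: if_splits)
  show "(+) t ` supp f \<subseteq> supp (mon_times t f)"
    using coeff_of_mon_times[of t f] by (auto simp: supp_def coeff_of_def in_keys_iff)
qed

lemma coeff_of_eq_0_iff: "coeff_of f u = 0 \<longleftrightarrow> u \<notin> supp f"
  by (simp add: coeff_of_def supp_def in_keys_iff)

text \<open>Justifies the definite description: a finite set has exactly one strictly sorted listing
  with respect to a strict total order.\<close>

lemma mons_desc:
  assumes "term_order prec"
  shows "sorted_wrt (\<lambda>u v. prec v u) (mons_desc prec f)" "set (mons_desc prec f) = supp f"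
proof -
  from assms have irr: "irreflp prec" and tr: "transp prec" and tot: "totalp prec"
    by (auto simp: term_order_def)
  \<comment> \<open>With the order reversed, descending lists become the ascending lists of the
    \<open>linorder\<close> library.\<close>
  interpret desc: linorder "\<lambda>u v. u = v \<or> prec v u" "\<lambda>u v. prec v u"
    using irr tr tot unfolding irreflp_def totalp_on_def transp_def by unfold_locales blast+
  define ms where "ms = desc.sorted_list_of_set (supp f)"
  have ms: "sorted_wrt (\<lambda>u v. prec v u) ms" "set ms = supp f"
    unfolding ms_def by (rule desc.strict_sorted_list_of_set) (simp add: supp_def)
  have "\<exists>!ms. sorted_wrt (\<lambda>u v. prec v u) ms \<and> set ms = supp f"
    by (rule ex1I[of _ ms]) (use ms in \<open>simp_all add: desc.strict_sorted_equal\<close>)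
  from theI'[OF this]
  show "sorted_wrt (\<lambda>u v. prec v u) (mons_desc prec f)" "set (mons_desc prec f) = supp f"
    by (simp_all add: mons_desc_def)
qed

lemma distinct_mons_desc:
  assumes "term_order prec"
  shows "distinct (mons_desc prec f)"
proof -
  have "irreflp prec"
    using assms by (simp add: term_order_def)
  then have "sorted_wrt (\<lambda>u v. prec v u) ms \<Longrightarrow> distinct ms" for ms
    by (induction ms) (auto dest: irreflpD)
  then show ?thesis
    using mons_desc(1)[OF assms] .
qed

section \<open>Indexing and segments\<close>

lemma index_in_nth1:
  assumes "distinct xs" "1 \<le> j" "j \<le> length xs"
  shows "index_in xs (xs !\<^sub>1 j) = j"
  unfolding index_in_def
proof (rule the_equality)
  fix k
  assume "1 \<le> k \<and> k \<le> length xs \<and> xs !\<^sub>1 k = xs !\<^sub>1 j"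
  then have "k - 1 = j - 1"
    using assms nth_eq_iff_index_eq[of xs "k - 1" "j - 1"] by auto
  \<comment> \<open>Truncated subtraction sends 0 and 1 to the same value, so both lower bounds are
    required here.\<close>
  then show "k = j"
    using \<open>1 \<le> k \<and> _\<close> assms by linarith
qed (use assms in auto)

lemma index_in:
  assumes "distinct xs" "x \<in> set xs"
  shows "index_in xs x \<in> {1..length xs}" "xs !\<^sub>1 index_in xs x = x"
proof -
  obtain k where "k < length xs" "xs ! k = x"
    using assms(2) by (auto simp: in_set_conv_nth)
  then show "index_in xs x \<in> {1..length xs}" "xs !\<^sub>1 index_in xs x = x"
    using index_in_nth1[OF assms(1), of "Suc k"] by auto
qed

lemma inj_on_index_in: "distinct xs \<Longrightarrow> inj_on (index_in xs) (set xs)"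
  by (rule inj_on_inverseI[of _ "\<lambda>j. xs !\<^sub>1 j"]) (rule index_in(2))

text \<open>Lookups are made among keys, while the theorem speaks of indices among monomials; an
  injective relabelling keeps positions.\<close>

lemma index_in_map:
  assumes "inj_on F (set xs)" "distinct xs" "x \<in> set xs"
  shows "index_in (map F xs) (F x) = index_in xs x"
proof -
  define j where "j = index_in xs x"
  have j: "1 \<le> j" "j \<le> length xs" "xs !\<^sub>1 j = x"
    using index_in[OF assms(2,3)] by (auto simp: j_def)
  then have "map F xs !\<^sub>1 j = F x"
    by simp
  with j assms index_in_nth1[of "map F xs" j] show ?thesis
    by (simp add: distinct_map flip: j_def)
qed

lemma length_prefix_sums [simp]: "length (prefix_sums s ls) = Suc (length ls)"
  by (induction ls arbitrary: s) auto

lemma prefix_sums_nth: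
  "i \<le> length ls \<Longrightarrow> prefix_sums s ls ! i = s + sum_list (take i ls)"
proof (induction ls arbitrary: s i)
  case (Cons l ls)
  then show ?case
    by (cases i) auto
qed simp

lemma prefix_sums_ge: "x \<in> set (prefix_sums s ls) \<Longrightarrow> s \<le> x"
proof (induction ls arbitrary: s)
  case (Cons l ls)
  then show ?case
    using Cons.IH[of "s + l"] by (auto dest: add_leD1)
qed simp

lemma sorted_prefix_sums: "sorted (prefix_sums s ls)"
  by (induction ls arbitrary: s) (auto dest!: prefix_sums_ge)

lemma seg_disjoint:
  assumes "sorted rp" "i \<in> {1..<length rp}" "k \<in> {1..<length rp}" "q \<in> seg rp i" "q \<in> seg rp k"
  shows "i = k"
proof -
  have "\<not> i < k" if "i \<in> {1..<length rp}" "k \<in> {1..<length rp}" "q \<in> seg rp i" "q \<in> seg rp k" for i k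
  proof
    assume "i < k"
    \<comment> \<open>In 0-based terms, \<open>rp ! i\<close> is the end of segment i and
      \<open>rp ! (k - 1)\<close> the start of segment k.\<close>
    then have "rp ! i \<le> rp ! (k - 1)"
      using assms(1) that by (intro sorted_nth_mono) auto
    then show False
      using that by (auto simp: seg_def)
  qed
  then show ?thesis
    using assms by (cases i k rule: linorder_cases) blast+
qed

text \<open>Either q lies below the boundary \<open>rp ! n\<close>, and the induction hypothesis
  applies, or q lies in the last segment.\<close>

lemma seg_cover:
  assumes "rp ! 0 = 0" "q < rp ! n"
  shows "\<exists>i\<in>{1..n}. q \<in> seg rp i"
  using assms(2)
proof (induction n)
  case 0
  then show ?case
    using assms(1) by simp
next
  case (Suc n)
  show ?case
  proof (cases "q < rp ! n")
    case True
    with Suc.IH obtain i where "i \<in> {1..n}" "q \<in> seg rp i"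
      by blast
    then show ?thesis
      by (intro bexI[of _ i]) auto
  next
    case False
    with Suc.prems show ?thesis
      by (intro bexI[of _ "Suc n"]) (auto simp: seg_def)
  qed
qed

section \<open>Parallel phases\<close>

lemma length_par_exec:
  assumes "par_exec ws a a'"
  shows "length a' = length a"
proof -
  have "length (fold (\<lambda>(q, x) b. b[q := x]) sch a) = length a" for sch :: "(nat \<times> 'a) list"
    by (induction sch arbitrary: a) auto
  then show ?thesis
    using assms by (auto simp: par_exec_def)
qed

text \<open>The last write to a cell decides, but all writes to q agree, so it need not be
  identified. The third hypothesis is the induction invariant: a write to q is still pending, or the
  cell already holds v.\<close>

lemma fold_writes_nth:
  assumes "\<forall>x. (q, x) \<in> set sch \<longrightarrow> x = v" "q < length a" "(\<exists>x. (q, x) \<in> set sch) \<or> a ! q = v"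
  shows "fold (\<lambda>(q, x) b. b[q := x]) sch a ! q = v"
  using assms
proof (induction sch arbitrary: a)
  case (Cons w sch)
  obtain k x where w: "w = (k, x)"
    by force
  have "(\<exists>y. (q, y) \<in> set sch) \<or> a[k := x] ! q = v"
  proof (cases "k = q")
    case True
    then have "x = v"
      using Cons.prems(1) by (simp add: w)
    with True Cons.prems(2) show ?thesis
      by simp
  next
    case False
    with Cons.prems(3) show ?thesis
      by (simp add: w)
  qed
  moreover have "\<forall>x. (q, x) \<in> set sch \<longrightarrow> x = v"
    using Cons.prems(1) by simp
  ultimately have "fold (\<lambda>(q, x) b. b[q := x]) sch (a[k := x]) ! q = v"
    using Cons.prems(2) by (intro Cons.IH) simp_all
  then show ?case
    by (simp add: w)
qed simp

lemma par_exec_nth: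
  assumes "par_exec ws a a'" "(q, v) \<in> set ws" "\<forall>x. (q, x) \<in> set ws \<longrightarrow> x = v" "q < length a"
  shows "a' ! q = v"
proof -
  obtain sch where sch: "mset sch = mset ws" "a' = fold (\<lambda>(q, x) b. b[q := x]) sch a"
    using assms(1) unfolding par_exec_def by blast
  have "set sch = set ws"
    using sch(1) by (rule mset_eq_setD)
  with assms(2-4) show ?thesis
    unfolding sch(2) by (intro fold_writes_nth) blast+
qed

text \<open>Since the segments of different rows are disjoint, the outcome does not depend on the schedule.\<close>

lemma par_exec_rows_nth:
  assumes "par_exec (concat (map W [1..<n + 1])) a a'"
    and W: "\<And>i. i \<in> {1..n} \<Longrightarrow> set (W i) = (\<lambda>q. (q, F i q)) ` seg rp i"
    and rp: "sorted rp" "length rp = n + 1" "rp ! n = length a"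
    and i: "i \<in> {1..n}" and q: "q \<in> seg rp i"
  shows "a' ! q = F i q"
proof (rule par_exec_nth[OF assms(1)])
  have set_ws: "set (concat (map W [1..<n + 1])) = (\<Union>i\<in>{1..n}. (\<lambda>q. (q, F i q)) ` seg rp i)"
  proof -
    have "set (concat (map W [1..<n + 1])) = (\<Union>i\<in>{1..n}. set (W i))"
      unfolding set_concat set_map set_upt image_image by (intro SUP_cong) auto
    with W show ?thesis
      by simp
  qed
  show "(q, F i q) \<in> set (concat (map W [1..<n + 1]))"
    unfolding set_ws using i q by auto
  show "\<forall>x. (q, x) \<in> set (concat (map W [1..<n + 1])) \<longrightarrow> x = F i q"
  proof (intro allI impI)
    fix x
    assume "(q, x) \<in> set (concat (map W [1..<n + 1]))"
    then obtain k where k: "k \<in> {1..n}" "q \<in> seg rp k" "x = F k q"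
      unfolding set_ws by blast
    have "i = k"
      by (rule seg_disjoint[OF rp(1) _ _ q k(2)]) (use i k(1) rp(2) in auto)
    with k(3) show "x = F i q"
      by simp
  qed
  \<comment> \<open>The position must lie inside the array, since a list update out of bounds has no
    effect.\<close>
  have "rp ! i \<le> rp ! n"
    using rp i by (intro sorted_nth_mono) auto
  then show "q < length a"
    using q rp by (simp add: seg_def)
qed

text \<open>Reindexes the writes by absolute position instead of offset, the shape that
  \<open>par_exec_rows_nth\<close> takes.\<close>

lemma set_fill_writes:
  "set (fill_writes prec s l f F) = (\<lambda>q. (q, F (mons_desc prec f ! (q - s)))) ` {s..<s + l}"
proof -
  have "{s..<s + l} = (+) s ` {0..<l}"
    by (simp add: add.commute)
  then show ?thesis
    by (simp only: fill_writes_def set_map set_upt image_image) simp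
qed

section \<open>The dictionary\<close>

text \<open>Sorting makes equal keys adjacent, so once adjacent duplicates are gone, neighbours are
  ordered and distinct; transitivity extends this to all pairs.\<close>

lemma sorted_wrt_remdups_adj_rev_sort:
  fixes xs :: "'a :: linorder list"
  shows "sorted_wrt (>) (remdups_adj (rev (sort xs)))"
proof -
  have "successively (<) (remdups_adj (sort xs))"
    using distinct_adj_remdups_adj[of "sort xs"] sorted_remdups_adj[OF sorted_sort, of xs]
    unfolding distinct_adj_def successively_conv_nth sorted_iff_nth_Suc less_le
    by blast
  then have "sorted_wrt (<) (remdups_adj (sort xs))"
    by (simp add: successively_conv_sorted_wrt)
  then show ?thesis
    by (simp add: sorted_wrt_rev)
qed

section \<open>Correctness of the sparse buffers\<close>

theorem theorem11p6:
  fixes prec :: "('n :: finite) mon \<Rightarrow> 'n mon \<Rightarrow> bool"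
    and MonKey :: "'n mon \<Rightarrow> 'k :: linorder"
    and G :: "('n, 'p :: prime_card) mpoly_Fp set"
    and g :: "nat \<Rightarrow> ('n, 'p) mpoly_Fp"
    and T :: "'n mon list"
    and R :: "('n mon \<times> ('n, 'p) mpoly_Fp) list"
    and P :: "('n, 'p, 'k) buffers"
    and A :: "'p mod_ring mat"
  assumes "term_order prec"
    and "finite G" and "bij_betw g {1..card G} G"
    and "inj MonKey"
    and "\<And>u v. prec u v \<Longrightarrow> MonKey u < MonKey v"
    and "FBSP prec MonKey G g T R P"
    and "A = coeff_matrix T R"
  shows "sorted_wrt (\<lambda>u v. prec v u) T \<and>
    encodes_matrix (row_ptr P) (col_ind P) (val P) A \<and>
    (\<forall>i \<in> {1..length R}. \<forall>t f. R !\<^sub>1 i = (t, f) \<longrightarrow>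
      (\<forall>u \<in> supp (mon_times t f). u \<in> set T \<and>
        (\<exists>!q. q \<in> seg (row_ptr P) i \<and>
          col_ind P ! q = index_in T u \<and> val P ! q = coeff_of (mon_times t f) u)) \<and>
      (\<forall>q \<in> seg (row_ptr P) i. \<exists>u \<in> supp (mon_times t f).
          col_ind P ! q = index_in T u \<and> val P ! q = coeff_of (mon_times t f) u))"
proof -
  note order = assms(1) and inj = assms(4) and MonKey_less = assms(5)
  define rp where "rp = row_ptr P"
  define D where "D = dict_keys P"
  define n where "n = length R"
  obtain sel ls M key0 val0 col0 row_key where
    ls: "ls = map (\<lambda>(t, f). card (supp (mon_times t f))) R"
    and rp: "rp = prefix_sums 0 ls"
    and M: "M = sum_list ls"
    and len: "length key0 = M" "length val0 = M" "length col0 = M"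
    and key_exec: "par_exec (concat (map (\<lambda>i. case R !\<^sub>1 i of (t, f) \<Rightarrow>
        fill_writes prec (rp !\<^sub>1 i) (ls !\<^sub>1 i) f (\<lambda>m. MonKey (t + m))) [1..<n + 1])) key0 row_key"
    and val_exec: "par_exec (concat (map (\<lambda>i. case R !\<^sub>1 i of (t, f) \<Rightarrow>
        fill_writes prec (rp !\<^sub>1 i) (ls !\<^sub>1 i) f (coeff_of f)) [1..<n + 1])) val0 (val P)"
    and D: "D = remdups_adj (rev (sort row_key))"
    and T: "T = map (inv_into UNIV MonKey) D"
    and col_exec: "par_exec (concat (map (\<lambda>i. map (\<lambda>q. (q, index_in D (row_key ! q)))
        [rp !\<^sub>1 i ..< rp !\<^sub>1 (i + 1)]) [1..<n + 1])) col0 (col_ind P)"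
    using assms(6) unfolding FBSP_def rp_def D_def n_def by blast

  define S where "S i = (case R !\<^sub>1 i of (t, f) \<Rightarrow> supp (mon_times t f))" for i
  \<comment> \<open>The monomial that position q of row i stands for; the contents of all three
    arrays are expressed through it.\<close>
  define mon where "mon i q = (case R !\<^sub>1 i of (t, f) \<Rightarrow> t + mons_desc prec f ! (q - rp !\<^sub>1 i))" for i q
  define cf where "cf i u = (case R !\<^sub>1 i of (t, f) \<Rightarrow> coeff_of (mon_times t f) u)" for i u

  have len_ls: "length ls = n"
    by (simp add: ls n_def)
  have len_rp: "length rp = n + 1" and sorted_rp: "sorted rp" and rp_0: "rp ! 0 = 0" and rp_n: "rp ! n = M"
    by (simp_all add: rp len_ls sorted_prefix_sums prefix_sums_nth M)
  have seg_rp: "seg rp i = {rp !\<^sub>1 i ..< rp !\<^sub>1 i + ls !\<^sub>1 i}" if "i \<in> {1..n}" for i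
  proof -
    have "rp ! i = rp !\<^sub>1 i + ls !\<^sub>1 i"
      using that take_Suc_conv_app_nth[of "i - 1" ls] by (auto simp: rp prefix_sums_nth len_ls)
    then show ?thesis
      by (simp add: seg_def)
  qed

  \<comment> \<open>Contents of the arrays, position by position\<close>
  have mon_bij: "bij_betw (mon i) (seg rp i) (S i)" if i: "i \<in> {1..n}" for i
  proof -
    obtain t f where tf: "R !\<^sub>1 i = (t, f)"
      by force
    \<comment> \<open>The count is taken on the support of \<open>t f\<close>, whereas the fill
      enumerates the monomials of \<open>f\<close>; the two agree because adding \<open>t\<close> is
      injective.\<close>
    have "ls !\<^sub>1 i = card ((+) t ` supp f)"
      using i tf by (auto simp: ls n_def supp_mon_times)
    also have "\<dots> = card (set (mons_desc prec f))"
      by (simp add: card_image mons_desc[OF order])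
    also have "\<dots> = length (mons_desc prec f)"
      by (intro distinct_card distinct_mons_desc order)
    finally have ls_i: "ls !\<^sub>1 i = length (mons_desc prec f)" .
    have "bij_betw (\<lambda>q. q - rp !\<^sub>1 i) (seg rp i) {..<ls !\<^sub>1 i}"
      unfolding seg_rp[OF i] by (rule bij_betw_byWitness[where f' = "\<lambda>j. j + rp !\<^sub>1 i"]) auto
    moreover have "bij_betw ((!) (mons_desc prec f)) {..<ls !\<^sub>1 i} (supp f)"
      unfolding ls_i by (intro bij_betw_nth distinct_mons_desc order) (simp_all add: mons_desc[OF order])
    moreover have "bij_betw ((+) t) (supp f) (S i)"
      unfolding S_def tf by (simp add: supp_mon_times inj_on_imp_bij_betw)
    ultimately have "bij_betw ((+) t \<circ> ((!) (mons_desc prec f) \<circ> (\<lambda>q. q - rp !\<^sub>1 i))) (seg rp i) (S i)"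
      by (blast intro: bij_betw_trans)
    then show ?thesis
      unfolding mon_def tf by (simp add: o_def)
  qed

  have row_key: "row_key ! q = MonKey (mon i q)" if "i \<in> {1..n}" "q \<in> seg rp i" for i q
  proof (rule par_exec_rows_nth[OF key_exec _ sorted_rp len_rp _ that])
    show "set (case R !\<^sub>1 i of (t, f) \<Rightarrow>
        fill_writes prec (rp !\<^sub>1 i) (ls !\<^sub>1 i) f (\<lambda>m. MonKey (t + m))) =
        (\<lambda>q. (q, MonKey (mon i q))) ` seg rp i" if "i \<in> {1..n}" for i
      by (cases "R !\<^sub>1 i") (simp add: mon_def set_fill_writes seg_rp[OF that])
  qed (simp add: rp_n len)
  \<comment> \<open>What is written is a coefficient of \<open>f\<close>;
    \<open>coeff_of_mon_times\<close> identifies it with the coefficient of \<open>t f\<close> at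
    the shifted monomial.\<close>
  have val: "val P ! q = cf i (mon i q)" if "i \<in> {1..n}" "q \<in> seg rp i" for i q
  proof (rule par_exec_rows_nth[OF val_exec _ sorted_rp len_rp _ that])
    show "set (case R !\<^sub>1 i of (t, f) \<Rightarrow>
        fill_writes prec (rp !\<^sub>1 i) (ls !\<^sub>1 i) f (coeff_of f)) =
        (\<lambda>q. (q, cf i (mon i q))) ` seg rp i" if "i \<in> {1..n}" for i
      by (cases "R !\<^sub>1 i") (simp add: mon_def cf_def set_fill_writes seg_rp[OF that])
  qed (simp add: rp_n len)
  have col_key: "col_ind P ! q = index_in D (row_key ! q)" if "i \<in> {1..n}" "q \<in> seg rp i" for i q
    by (rule par_exec_rows_nth[OF col_exec _ sorted_rp len_rp _ that]) (simp_all add: seg_def rp_n len)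

  \<comment> \<open>The dictionary and its decoding\<close>
  have set_D: "set D = (\<Union>i\<in>{1..n}. MonKey ` S i)"
  proof -
    \<comment> \<open>Every cell of \<open>row_key\<close> belongs to a row, so no arbitrary initial
      key can reach the dictionary.\<close>
    have "{..<M} = (\<Union>i\<in>{1..n}. seg rp i)"
    proof
      show "{..<M} \<subseteq> (\<Union>i\<in>{1..n}. seg rp i)"
        using seg_cover[OF rp_0, of _ n] by (auto simp: rp_n)
      show "(\<Union>i\<in>{1..n}. seg rp i) \<subseteq> {..<M}"
        using sorted_nth_mono[OF sorted_rp, of _ n] by (fastforce simp: seg_def len_rp rp_n)
    qed
    moreover have "set row_key = (!) row_key ` {..<M}"
      using length_par_exec[OF key_exec] by (auto simp: len set_conv_nth)
    ultimately have "set D = (\<Union>i\<in>{1..n}. (!) row_key ` seg rp i)"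
      by (simp add: D image_UN)
    also have "\<dots> = (\<Union>i\<in>{1..n}. MonKey ` mon i ` seg rp i)"
      using row_key by (auto simp: image_image)
    also have "\<dots> = (\<Union>i\<in>{1..n}. MonKey ` S i)"
      using mon_bij by (simp add: bij_betw_def)
    finally show ?thesis .
  qed
  \<comment> \<open>\<open>inv_into\<close> is a genuine inverse only on the range of
    \<open>MonKey\<close>.\<close>
  have "set D \<subseteq> range MonKey"
    by (auto simp: set_D)
  then have map_T: "map MonKey T = D"
    unfolding T map_map by (intro map_idI) (auto simp: f_inv_into_f)
  have "sorted_wrt (\<lambda>u v. MonKey v < MonKey u) T"
    using sorted_wrt_remdups_adj_rev_sort[of row_key]
    unfolding D[symmetric] map_T[symmetric] sorted_wrt_map .
  then have sorted_T: "sorted_wrt (\<lambda>u v. prec v u) T"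
  \<comment> \<open>\<open>MonKey\<close> is only assumed to preserve the order; totality of
    \<open>prec\<close> yields the converse needed here.\<close>
  proof (rule sorted_wrt_mono_rel[rotated])
    fix u v
    assume less: "MonKey v < MonKey u"
    have "totalp prec"
      using order by (simp add: term_order_def)
    moreover have "u \<noteq> v" "\<not> prec u v"
      using less MonKey_less[of u v] by auto
    ultimately show "prec v u"
      by (blast dest: totalpD)
  qed
  have "distinct D"
    using sorted_wrt_remdups_adj_rev_sort[of row_key]
    unfolding D[symmetric] sorted_wrt_rev[of "(<)", symmetric] strict_sorted_iff by simp
  then have distinct_T: "distinct T"
    by (simp flip: map_T add: distinct_map)
  have "MonKey ` set T = MonKey ` (\<Union>i\<in>{1..n}. S i)"
    unfolding image_UN set_D[symmetric] map_T[symmetric] by simp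
  then have S_T: "S i \<subseteq> set T" if "i \<in> {1..n}" for i
    using that by (auto simp: inj_image_eq_iff[OF inj])

  have col: "col_ind P ! q = index_in T (mon i q)" if "i \<in> {1..n}" "q \<in> seg rp i" for i q
  proof -
    have "mon i q \<in> set T"
      using that S_T mon_bij[THEN bij_betwE] by blast
    then show ?thesis
      using that distinct_T inj
      by (simp add: col_key row_key index_in_map inj_on_subset flip: map_T)
  qed

  \<comment> \<open>Rows of the buffers against rows of the matrix\<close>
  have A_entry: "A $$ (i - 1, j - 1) = cf i (T !\<^sub>1 j)" if "i \<in> {1..n}" "j \<in> {1..length T}" for i j
    using that by (auto simp: assms(7) coeff_matrix_def cf_def n_def)
  have cf_0: "cf i u = 0 \<longleftrightarrow> u \<notin> S i" for i u
    by (cases "R !\<^sub>1 i") (simp add: cf_def S_def coeff_of_eq_0_iff)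
  have inj_col: "inj_on (\<lambda>q. col_ind P ! q) (seg rp i)" if i: "i \<in> {1..n}" for i
  proof -
    have "inj_on (index_in T \<circ> mon i) (seg rp i)"
      using mon_bij[OF i] inj_on_index_in[OF distinct_T] S_T[OF i]
      by (auto simp: bij_betw_def intro!: comp_inj_on intro: inj_on_subset)
    then show ?thesis
      using col[OF i] by (simp cong: inj_on_cong)
  qed
  have row: "(\<lambda>q. (col_ind P ! q, val P ! q)) ` seg rp i = (\<lambda>u. (index_in T u, cf i u)) ` S i"
    if i: "i \<in> {1..n}" for i
  proof -
    have "(\<lambda>q. (col_ind P ! q, val P ! q)) ` seg rp i = (\<lambda>u. (index_in T u, cf i u)) ` mon i ` seg rp i"
      unfolding image_image using col[OF i] val[OF i] by (intro image_cong) auto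
    then show ?thesis
      using mon_bij[OF i] by (simp add: bij_betw_def)
  qed
  \<comment> \<open>\<open>index_in T\<close> and \<open>!\<^sub>1\<close> are mutually inverse, and
    by \<open>cf_0\<close> an entry is nonzero exactly when its column monomial lies in
    \<open>S i\<close>.\<close>
  have support_row: "(\<lambda>u. (index_in T u, cf i u)) ` S i =
      {(j, A $$ (i - 1, j - 1)) | j. j \<in> {1..dim_col A} \<and> A $$ (i - 1, j - 1) \<noteq> 0}"
    if i: "i \<in> {1..n}" for i
  proof -
    have dim: "dim_col A = length T"
      by (simp add: assms(7) coeff_matrix_def)
    have "(index_in T u, cf i u) = (j, A $$ (i - 1, j - 1)) \<and> j \<in> {1..length T} \<and> A $$ (i - 1, j - 1) \<noteq> 0"
      if "u \<in> S i" "j = index_in T u" for u j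
      using that index_in[OF distinct_T, of u] S_T[OF i] A_entry[OF i, of j] cf_0[of i u] by auto
    moreover have "T !\<^sub>1 j \<in> S i \<and> (j, A $$ (i - 1, j - 1)) = (index_in T (T !\<^sub>1 j), cf i (T !\<^sub>1 j))"
      if "j \<in> {1..length T}" "A $$ (i - 1, j - 1) \<noteq> 0" for j
      using that index_in_nth1[OF distinct_T, of j] A_entry[OF i, of j] cf_0[of i "T !\<^sub>1 j"] by auto
    ultimately show ?thesis
      unfolding dim by blast
  qed

  have encodes: "encodes_matrix rp (col_ind P) (val P) A"
  proof -
    have "dim_row A = n"
      by (simp add: assms(7) coeff_matrix_def n_def)
    moreover have "length (col_ind P) = M" "length (val P) = M"
      using length_par_exec[OF col_exec] length_par_exec[OF val_exec] by (simp_all add: len)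
    ultimately show ?thesis
      using inj_col row support_row
      by (simp add: encodes_matrix_def len_rp sorted_rp rp_0 rp_n)
  qed
  have entries: "(\<forall>u \<in> S i. u \<in> set T \<and>
        (\<exists>!q. q \<in> seg rp i \<and> col_ind P ! q = index_in T u \<and> val P ! q = cf i u)) \<and>
      (\<forall>q \<in> seg rp i. \<exists>u \<in> S i. col_ind P ! q = index_in T u \<and> val P ! q = cf i u)"
    if i: "i \<in> {1..n}" for i
  proof (intro conjI ballI)
    fix u
    assume u: "u \<in> S i"
    then show "u \<in> set T"
      using S_T[OF i] by blast
    from u have "(index_in T u, cf i u) \<in> (\<lambda>q. (col_ind P ! q, val P ! q)) ` seg rp i"
      unfolding row[OF i] by blast
    \<comment> \<open>Existence comes from \<open>row\<close>; for uniqueness the column alone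
      determines the position, by \<open>inj_col\<close>.\<close>
    then show "\<exists>!q. q \<in> seg rp i \<and> col_ind P ! q = index_in T u \<and> val P ! q = cf i u"
      by (force dest: inj_onD[OF inj_col[OF i]])
  next
    fix q
    assume "q \<in> seg rp i"
    then have "(col_ind P ! q, val P ! q) \<in> (\<lambda>u. (index_in T u, cf i u)) ` S i"
      unfolding row[OF i, symmetric] by blast
    then show "\<exists>u \<in> S i. col_ind P ! q = index_in T u \<and> val P ! q = cf i u"
      by blast
  qed
  have "\<forall>i \<in> {1..length R}. \<forall>t f. R !\<^sub>1 i = (t, f) \<longrightarrow>
      (\<forall>u \<in> supp (mon_times t f). u \<in> set T \<and>
        (\<exists>!q. q \<in> seg (row_ptr P) i \<and>
          col_ind P ! q = index_in T u \<and> val P ! q = coeff_of (mon_times t f) u)) \<and>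
      (\<forall>q \<in> seg (row_ptr P) i. \<exists>u \<in> supp (mon_times t f).
          col_ind P ! q = index_in T u \<and> val P ! q = coeff_of (mon_times t f) u)"
  proof (intro ballI allI impI)
    fix i t f
    assume "i \<in> {1..length R}" and tf: "R !\<^sub>1 i = (t, f)"
    moreover have "S i = supp (mon_times t f)" "cf i = coeff_of (mon_times t f)"
      unfolding S_def cf_def[abs_def] tf by simp_all
    ultimately show "(\<forall>u \<in> supp (mon_times t f). u \<in> set T \<and>
        (\<exists>!q. q \<in> seg (row_ptr P) i \<and>
          col_ind P ! q = index_in T u \<and> val P ! q = coeff_of (mon_times t f) u)) \<and>
      (\<forall>q \<in> seg (row_ptr P) i. \<exists>u \<in> supp (mon_times t f).
          col_ind P ! q = index_in T u \<and> val P ! q = coeff_of (mon_times t f) u)"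
      using entries[of i] unfolding n_def rp_def by simp
  qed
  with sorted_T encodes show ?thesis
    unfolding rp_def by blast
qed

end
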